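(* Let $N\ge 1$, and let $R_1,\dots,R_N$ be the measurements $R_i = M_i(d_0,\theta_0)+X_i$ with true position $(d_0,\theta_0)$, $d_0>0$, and noise values $X_1,\dots,X_N\in\mathbb R$ (realizations of independent $\mathcal N(0,\sigma^2)$ random variables). Let $(\hat d,\hat\theta)$ with $\hat d>0$ be the maximum likelihood estimate obtained as a solution of the likelihood equations $$\sum_{i=1}^N\big(R_i-M_i(\hat d,\hat\theta)\big)\,\frac{\partial M_i}{\partial d}(\hat d,\hat\theta)=0,\qquad \sum_{i=1}^N\big(R_i-M_i(\hat d,\hat\theta)\big)\,\frac{\partial M_i}{\partial \theta}(\hat d,\hat\theta)=0 .$$ Then $\hat\theta$ solves the equation $$10\,n\,\log_{10}\!\left(\prod_{i=1}^N\Gamma_i(\hat\theta)^{\frac{\mathcal H-N K_i}{nN}}\right)+\sum_{i=1}^N\Big(K_i-\frac{\mathcal H}{N}\Big)X_i=0,$$ where $$\Gamma_i(\hat\theta)=\frac{G_T(\hat\theta+\Delta_i)}{G_T(\theta_0+\Delta_i)},\qquad K_i=\frac{10}{\ln 10}\cdot\frac{G_T'(\hat\theta+\Delta_i)}{G_T(\hat\theta+\Delta_i)},\qquad \mathcal H=\sum_{i=1}^N K_i .$$ This equation for $\hat\theta$ is independent of the distance parameter: it involves neither $d_0$ nor $\hat d$.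
   Context: A transmitter with a known, strictly positive, differentiable gain pattern $G_T:\mathbb R\to(0,\infty)$ (gain as a function of angle) is rotated through known angles $\Delta_1,\dots,\Delta_N\in\mathbb R$. The receiver has constant gain $G_R>0$ and unknown position given by distance $d>0$ and angle $\theta\in\mathbb R$. $A>0$ is a known constant and $n>0$ is the known path loss exponent. For $i=1,\dots,N$ the mean received signal strength (in dBm) at position $(d,\theta)$ is $$M_i(d,\theta)=30+10\log_{10}\!\left(\frac{A^2\,G_T(\theta+\Delta_i)\,G_R}{d^n}\right).$$ The log-likelihood of the measurements is $\ln L(d,\theta)=-\frac N2\ln(2\pi\sigma^2)-\frac1{2\sigma^2}\sum_{i=1}^N(R_i-M_i(d,\theta))^2$, and the maximum likelihood estimate is obtained by setting its partial derivatives in $d$ and $\theta$ to zero. *)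

theory Defs
  imports "HOL-Analysis.Analysis"
begin

definition mean_rss ::
  "real \<Rightarrow> real \<Rightarrow> real \<Rightarrow> (real \<Rightarrow> real) \<Rightarrow> (nat \<Rightarrow> real) \<Rightarrow> nat \<Rightarrow> real \<Rightarrow> real \<Rightarrow> real"
  where "mean_rss A G\<^sub>R n G\<^sub>T \<Delta> i d \<theta> =
    30 + 10 * log 10 (A\<^sup>2 * G\<^sub>T (\<theta> + \<Delta> i) * G\<^sub>R / d powr n)"

text \<open>
  The likelihood equations: up to the factor \<open>1 / \<sigma>\<^sup>2\<close>, the partial derivatives of the Gaussian
  log-likelihood of the measurements \<open>R\<close> in distance and angle, set to zero. They do not involve
  the true position.
\<close>

definition likelihood_eq_distance ::
  "real \<Rightarrow> real \<Rightarrow> real \<Rightarrow> (real \<Rightarrow> real) \<Rightarrow> (nat \<Rightarrow> real) \<Rightarrow> nat \<Rightarrow> (nat \<Rightarrow> real) \<Rightarrow> real \<Rightarrow> real \<Rightarrow> bool"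
  where "likelihood_eq_distance A G\<^sub>R n G\<^sub>T \<Delta> N R d \<theta> \<longleftrightarrow>
    (\<Sum>i = 1..N. (R i - mean_rss A G\<^sub>R n G\<^sub>T \<Delta> i d \<theta>) *
       deriv (\<lambda>d'. mean_rss A G\<^sub>R n G\<^sub>T \<Delta> i d' \<theta>) d) = 0"

definition likelihood_eq_angle ::
  "real \<Rightarrow> real \<Rightarrow> real \<Rightarrow> (real \<Rightarrow> real) \<Rightarrow> (nat \<Rightarrow> real) \<Rightarrow> nat \<Rightarrow> (nat \<Rightarrow> real) \<Rightarrow> real \<Rightarrow> real \<Rightarrow> bool"
  where "likelihood_eq_angle A G\<^sub>R n G\<^sub>T \<Delta> N R d \<theta> \<longleftrightarrow>
    (\<Sum>i = 1..N. (R i - mean_rss A G\<^sub>R n G\<^sub>T \<Delta> i d \<theta>) *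
       deriv (\<lambda>\<theta>'. mean_rss A G\<^sub>R n G\<^sub>T \<Delta> i d \<theta>') \<theta>) = 0"

definition gain_ratio :: "(real \<Rightarrow> real) \<Rightarrow> (nat \<Rightarrow> real) \<Rightarrow> real \<Rightarrow> nat \<Rightarrow> real \<Rightarrow> real"
  where "gain_ratio G\<^sub>T \<Delta> \<theta>\<^sub>0 i \<theta> = G\<^sub>T (\<theta> + \<Delta> i) / G\<^sub>T (\<theta>\<^sub>0 + \<Delta> i)"

definition gain_slope :: "(real \<Rightarrow> real) \<Rightarrow> (nat \<Rightarrow> real) \<Rightarrow> nat \<Rightarrow> real \<Rightarrow> real"
  where "gain_slope G\<^sub>T \<Delta> i \<theta> = 10 / ln 10 * (deriv G\<^sub>T (\<theta> + \<Delta> i) / G\<^sub>T (\<theta> + \<Delta> i))"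

definition total_slope :: "(real \<Rightarrow> real) \<Rightarrow> (nat \<Rightarrow> real) \<Rightarrow> nat \<Rightarrow> real \<Rightarrow> real"
  where "total_slope G\<^sub>T \<Delta> N \<theta> = (\<Sum>i = 1..N. gain_slope G\<^sub>T \<Delta> i \<theta>)"

end

theory Submission
  imports Defs
begin

text \<open>
  Passing to logarithms separates distance from angle: the residual at the estimate is
  \<open>X i + c - 10 * log 10 (\<Gamma> i)\<close>, where \<open>c\<close> carries all dependence on the distances and not on \<open>i\<close>. The
  distance equation says that the residuals sum to zero, the angle equation that they are
  orthogonal to the slopes \<open>K i\<close>. Hence they are orthogonal to the centred slopes, and \<open>c\<close> drops
  out because these sum to zero.
\<close>

lemma mean_rss_expand:
  assumes "G\<^sub>T (\<theta> + \<Delta> i) > 0" "A > 0" "G\<^sub>R > 0" "d > 0"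
  shows "mean_rss A G\<^sub>R n G\<^sub>T \<Delta> i d \<theta> =
    30 + 10 * log 10 (A\<^sup>2 * G\<^sub>R) + 10 * log 10 (G\<^sub>T (\<theta> + \<Delta> i)) - 10 * n * log 10 d"
  using assms by (simp add: mean_rss_def log_mult log_divide log_powr algebra_simps)

text \<open>The derivative depends neither on \<open>i\<close> nor on the angle, because distance
  enters only through the path loss term. It is therefore a common nonzero factor of the distance
  equation, which then says that the residuals sum to zero.\<close>

lemma deriv_mean_rss_distance:
  assumes "G\<^sub>T (\<theta> + \<Delta> i) > 0" "A > 0" "G\<^sub>R > 0" "d > 0"
  shows "deriv (\<lambda>d'. mean_rss A G\<^sub>R n G\<^sub>T \<Delta> i d' \<theta>) d = - (10 * n / (d * ln 10))"
proof (rule DERIV_imp_deriv)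
  have *: "((\<lambda>d'. 30 + 10 * log 10 (A\<^sup>2 * G\<^sub>R) + 10 * log 10 (G\<^sub>T (\<theta> + \<Delta> i)) - 10 * n * log 10 d')
      has_real_derivative - (10 * n / (d * ln 10))) (at d)"
    using assms(4) unfolding log_def by (auto intro!: derivative_eq_intros simp: field_simps)
  show "((\<lambda>d'. mean_rss A G\<^sub>R n G\<^sub>T \<Delta> i d' \<theta>) has_real_derivative - (10 * n / (d * ln 10))) (at d)"
    \<comment> \<open>The logarithmic expansion holds only for positive distance, so the derivative
      is transferred on the open half-line around \<open>d\<close>.\<close>
    by (rule has_field_derivative_transform_within_open[OF *, of "{0<..}"])
      (use assms in \<open>auto simp: mean_rss_expand\<close>)
qed

lemma deriv_mean_rss_angle:
  assumes "\<And>x. G\<^sub>T x > 0" "G\<^sub>T differentiable (at (\<theta> + \<Delta> i))" "A > 0" "G\<^sub>R > 0" "d > 0"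
  shows "deriv (\<lambda>\<theta>'. mean_rss A G\<^sub>R n G\<^sub>T \<Delta> i d \<theta>') \<theta> = gain_slope G\<^sub>T \<Delta> i \<theta>"
proof (rule DERIV_imp_deriv)
  have "(G\<^sub>T has_real_derivative deriv G\<^sub>T (\<theta> + \<Delta> i)) (at (\<theta> + \<Delta> i))"
    using assms(2) DERIV_deriv_iff_real_differentiable by blast
  then have D: "((\<lambda>\<theta>'. G\<^sub>T (\<theta>' + \<Delta> i)) has_real_derivative deriv G\<^sub>T (\<theta> + \<Delta> i)) (at \<theta>)"
    by (simp add: DERIV_shift)
  have "((\<lambda>\<theta>'. 30 + 10 * log 10 (A\<^sup>2 * G\<^sub>R) + 10 * log 10 (G\<^sub>T (\<theta>' + \<Delta> i)) - 10 * n * log 10 d)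
      has_real_derivative gain_slope G\<^sub>T \<Delta> i \<theta>) (at \<theta>)"
    unfolding log_def gain_slope_def
    using assms(1)[of "\<theta> + \<Delta> i"]
    by (auto intro!: derivative_eq_intros D simp: field_simps)
  then show "((\<lambda>\<theta>'. mean_rss A G\<^sub>R n G\<^sub>T \<Delta> i d \<theta>') has_real_derivative gain_slope G\<^sub>T \<Delta> i \<theta>) (at \<theta>)"
    using assms by (simp add: mean_rss_expand)
qed

text \<open>This turns the product in the final equation into a sum linear in the logarithms of the
  gain ratios. For infinite \<open>I\<close> the product is 1 and both sides vanish.\<close>

lemma log_prod_powr:
  fixes f e :: "'a \<Rightarrow> real"
  assumes "\<And>i. i \<in> I \<Longrightarrow> f i > 0"
  shows "log b (\<Prod>i\<in>I. f i powr e i) = (\<Sum>i\<in>I. e i * log b (f i))"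
  using assms
proof (induction I rule: infinite_finite_induct)
  case (insert i I)
  have "(\<Prod>j\<in>I. f j powr e j) > 0"
    by (intro prod_pos) (use insert.prems in \<open>simp add: less_imp_neq[symmetric]\<close>)
  moreover have "f i powr e i > 0"
    using insert.prems[of i] by simp
  ultimately show ?case
    using insert by (simp add: log_mult_pos log_powr del: powr_gt_zero prod_zero_iff)
qed auto

text \<open>Independence of distance is expressed by the quantifier order: \<open>F\<close> is fixed
  before both distances and the measurements.\<close>

theorem proposition2:
  fixes G\<^sub>T :: "real \<Rightarrow> real" and A G\<^sub>R n \<theta>\<^sub>0 :: real
    and N :: nat and \<Delta> X :: "nat \<Rightarrow> real"
  assumes "\<And>x. G\<^sub>T x > 0" and "\<And>x. G\<^sub>T differentiable (at x)"
    and "A > 0" and "G\<^sub>R > 0" and "n > 0" and "N \<ge> 1"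
  shows "\<exists>F :: real \<Rightarrow> real.
    (\<forall>\<theta>. F \<theta> =
      10 * n * log 10 (\<Prod>i = 1..N. gain_ratio G\<^sub>T \<Delta> \<theta>\<^sub>0 i \<theta> powr
        ((total_slope G\<^sub>T \<Delta> N \<theta> - real N * gain_slope G\<^sub>T \<Delta> i \<theta>) / (n * real N)))
      + (\<Sum>i = 1..N. (gain_slope G\<^sub>T \<Delta> i \<theta> - total_slope G\<^sub>T \<Delta> N \<theta> / real N) * X i)) \<and>
    (\<forall>d\<^sub>0 d\<^sub>e \<theta>\<^sub>e :: real. \<forall>R :: nat \<Rightarrow> real.
      d\<^sub>0 > 0 \<longrightarrow> d\<^sub>e > 0 \<longrightarrow>
      (\<forall>i\<in>{1..N}. R i = mean_rss A G\<^sub>R n G\<^sub>T \<Delta> i d\<^sub>0 \<theta>\<^sub>0 + X i) \<longrightarrow>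
      likelihood_eq_distance A G\<^sub>R n G\<^sub>T \<Delta> N R d\<^sub>e \<theta>\<^sub>e \<longrightarrow>
      likelihood_eq_angle A G\<^sub>R n G\<^sub>T \<Delta> N R d\<^sub>e \<theta>\<^sub>e \<longrightarrow>
      F \<theta>\<^sub>e = 0)"
\<comment> \<open>Unification in \<open>refl\<close> supplies the witness \<open>F\<close>, read off
  from its defining equation.\<close>
proof (intro exI conjI, rule allI, rule refl, intro allI impI)
  fix d\<^sub>0 d\<^sub>e \<theta>\<^sub>e :: real and R :: "nat \<Rightarrow> real"
  assume "d\<^sub>0 > 0" and "d\<^sub>e > 0"
    and R: "\<forall>i\<in>{1..N}. R i = mean_rss A G\<^sub>R n G\<^sub>T \<Delta> i d\<^sub>0 \<theta>\<^sub>0 + X i"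
    and dist: "likelihood_eq_distance A G\<^sub>R n G\<^sub>T \<Delta> N R d\<^sub>e \<theta>\<^sub>e"
    and angle: "likelihood_eq_angle A G\<^sub>R n G\<^sub>T \<Delta> N R d\<^sub>e \<theta>\<^sub>e"
  define K where "K i = gain_slope G\<^sub>T \<Delta> i \<theta>\<^sub>e" for i
  define H where "H = total_slope G\<^sub>T \<Delta> N \<theta>\<^sub>e"
  define L where "L i = log 10 (gain_ratio G\<^sub>T \<Delta> \<theta>\<^sub>0 i \<theta>\<^sub>e)" for i
  define r where "r i = R i - mean_rss A G\<^sub>R n G\<^sub>T \<Delta> i d\<^sub>e \<theta>\<^sub>e" for i
  define c where "c = 10 * n * (log 10 d\<^sub>e - log 10 d\<^sub>0)"
  have ratio_pos: "gain_ratio G\<^sub>T \<Delta> \<theta>\<^sub>0 i \<theta>\<^sub>e > 0" for i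
    using assms(1) by (simp add: gain_ratio_def)
  have L: "L i = log 10 (G\<^sub>T (\<theta>\<^sub>e + \<Delta> i)) - log 10 (G\<^sub>T (\<theta>\<^sub>0 + \<Delta> i))" for i
    using assms(1)[of "\<theta>\<^sub>e + \<Delta> i"] assms(1)[of "\<theta>\<^sub>0 + \<Delta> i"]
    by (simp add: L_def gain_ratio_def log_divide)
  \<comment> \<open>The terms 30 and \<open>10 * log 10 (A\<^sup>2 * G\<^sub>R)\<close> are the same
    in both means and cancel.\<close>
  have r: "r i = X i + c - 10 * L i" if "i \<in> {1..N}" for i
    using R that \<open>d\<^sub>0 > 0\<close> \<open>d\<^sub>e > 0\<close> assms
    by (simp add: r_def c_def L mean_rss_expand algebra_simps)
  have "(\<Sum>i = 1..N. r i) * (10 * n / (d\<^sub>e * ln 10)) = 0"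
    using dist \<open>d\<^sub>e > 0\<close> assms
    by (simp add: likelihood_eq_distance_def deriv_mean_rss_distance r_def sum_negf
        flip: sum_distrib_right sum_divide_distrib)
  then have sum_r: "(\<Sum>i = 1..N. r i) = 0"
    using \<open>d\<^sub>e > 0\<close> \<open>n > 0\<close> by simp
  have sum_rK: "(\<Sum>i = 1..N. r i * K i) = 0"
    using angle \<open>d\<^sub>e > 0\<close> assms
    by (simp add: likelihood_eq_angle_def deriv_mean_rss_angle r_def K_def)
  have "(\<Sum>i = 1..N. K i - H / real N) = 0"
    using \<open>N \<ge> 1\<close> by (simp add: sum_subtractf H_def total_slope_def K_def)
  then have sum_c: "(\<Sum>i = 1..N. (K i - H / real N) * c) = 0"
    by (simp flip: sum_distrib_right)
  \<comment> \<open>Centring the slopes amounts to subtracting \<open>H / real N\<close> times the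
    distance equation from the angle equation.\<close>
  have "(\<Sum>i = 1..N. (K i - H / real N) * r i) =
      (\<Sum>i = 1..N. r i * K i) - H / real N * (\<Sum>i = 1..N. r i)"
    by (simp add: sum_distrib_left algebra_simps flip: sum_subtractf)
  then have "0 = (\<Sum>i = 1..N. (K i - H / real N) * r i)"
    using sum_r sum_rK by simp
  also have "\<dots> = (\<Sum>i = 1..N. (K i - H / real N) * (X i - 10 * L i) + (K i - H / real N) * c)"
    by (intro sum.cong refl) (simp add: r ring_distribs)
  also have "\<dots> = (\<Sum>i = 1..N. (K i - H / real N) * (X i - 10 * L i))"
    by (simp only: sum.distrib sum_c add_0_right)
  \<comment> \<open>The coefficient \<open>- 10 * (K i - H / real N)\<close> of \<open>L i\<close>
    is written as \<open>10 * n\<close> times the required exponent; the factor \<open>n\<close>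
    cancels.\<close>
  also have "\<dots> = 10 * n * (\<Sum>i = 1..N. (H - real N * K i) / (n * real N) * L i) +
      (\<Sum>i = 1..N. (K i - H / real N) * X i)"
    unfolding sum_distrib_left sum.distrib[symmetric]
    using \<open>n > 0\<close> \<open>N \<ge> 1\<close> by (intro sum.cong refl) (simp add: field_simps)
  finally show "10 * n * log 10 (\<Prod>i = 1..N. gain_ratio G\<^sub>T \<Delta> \<theta>\<^sub>0 i \<theta>\<^sub>e powr
        ((total_slope G\<^sub>T \<Delta> N \<theta>\<^sub>e - real N * gain_slope G\<^sub>T \<Delta> i \<theta>\<^sub>e) / (n * real N)))
      + (\<Sum>i = 1..N. (gain_slope G\<^sub>T \<Delta> i \<theta>\<^sub>e - total_slope G\<^sub>T \<Delta> N \<theta>\<^sub>e / real N) * X i) = 0"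
    by (simp add: log_prod_powr ratio_pos L_def K_def H_def)
qed

end
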